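(* Let $\hat\rho_{12}$ and $\hat\rho_{34}$ be arbitrary (possibly mixed) two-qubit states, so that $\hat\rho_{12}\otimes\hat\rho_{34}$ is a four-qubit state on qubits $1,2,3,4$. Alice holds qubit $1$, Bob holds qubit $4$, and Sapna holds qubits $2$ and $3$. Suppose Alice, Bob and Sapna perform general three-party LOCC on the initial state $\hat\rho_{12}\otimes\hat\rho_{34}$, with outcome $\{Q_j,\hat\sigma_{14}^j\}_{j=1}^s$, where $Q_j$ is the probability of outcome $j$ and $\hat\sigma_{14}^j$ is the two-qubit state shared by Alice and Bob given outcome $j$. Then $$C_{14}\equiv\sum_{j=1}^{s}Q_j\,C(\hat\sigma_{14}^j)\;\le\;C_{12}\,C_{34},$$ where $C_{12}\equiv C(\hat\rho_{12})$, $C_{34}\equiv C(\hat\rho_{34})$, and $C$ denotes the concurrence.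
   Context: A state is a density operator (positive semidefinite, trace one); a qubit has Hilbert space $\mathbb{C}^2$. Concurrence: for a normalized pure bipartite state $|\psi\rangle$, $C(|\psi\rangle)=\sqrt{2(1-\mathrm{Tr}\,\hat\rho_r^2)}$, where $\hat\rho_r$ is obtained from $|\psi\rangle\langle\psi|$ by partial trace over one of the two shares. For a mixed bipartite state $\hat\rho$, $C(\hat\rho)=\min\sum_i p_iC(|\psi_i\rangle)$, the minimum being over all decompositions $\hat\rho=\sum_ip_i|\psi_i\rangle\langle\psi_i|$ into normalized pure states with probabilities $p_i$. LOCC (local operations and classical communication among all three parties): a finite sequence of rounds. In each round one party performs a generalized measurement on the systems it holds (possibly including local ancillas), described by Kraus operators $\hat M^{(i)}$ with $\sum_i\hat M^{(i)\dagger}\hat M^{(i)}=I$; the choice of measurement may depend on all earlier results, and the result $i$ is communicated to the other parties. The outcome label $j$ records the measurement results. If $\hat\sigma^j_{1234}$ is the normalized final state given outcome $j$, then $\hat\sigma_{14}^j=\mathrm{Tr}_{23}\,\hat\sigma^j_{1234}$ is its reduction to Alice's and Bob's qubits. *)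

theory Defs
  imports "HOL-Analysis.Analysis"
begin

type_synonym 'n cmat = "complex^'n^'n"

definition dagger :: "'n::finite cmat \<Rightarrow> 'n cmat" where
  "dagger A = (\<chi> i j. cnj (A $ j $ i))"

definition cinner :: "complex^'n::finite \<Rightarrow> complex^'n \<Rightarrow> complex" where
  "cinner x y = (\<Sum>i\<in>UNIV. cnj (x $ i) * y $ i)"

definition psd :: "'n::finite cmat \<Rightarrow> bool" where
  "psd A \<longleftrightarrow> dagger A = A \<and> (\<forall>x. 0 \<le> Re (cinner x (A *v x)))"

definition density_operator :: "'n::finite cmat \<Rightarrow> bool" where
  "density_operator A \<longleftrightarrow> psd A \<and> trace A = 1"

definition ketbra :: "complex^'n::finite \<Rightarrow> 'n cmat" where
  "ketbra \<psi> = (\<chi> i j. \<psi> $ i * cnj (\<psi> $ j))"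

text \<open>The space $\mathbb{C}^m \otimes \mathbb{C}^n$ is indexed by the product of the two index types.\<close>

definition tensor :: "'m::finite cmat \<Rightarrow> 'n::finite cmat \<Rightarrow> ('m \<times> 'n) cmat"  (infixr "\<otimes>" 75) where
  "A \<otimes> B = (\<chi> i j. A $ fst i $ fst j * B $ snd i $ snd j)"

definition ptrace_snd :: "('m::finite \<times> 'n::finite) cmat \<Rightarrow> 'm cmat" where
  "ptrace_snd A = (\<chi> i j. \<Sum>k\<in>UNIV. A $ (i, k) $ (j, k))"

definition reindex :: "('m::finite \<Rightarrow> 'n::finite) \<Rightarrow> 'n cmat \<Rightarrow> 'm cmat" where
  "reindex f A = (\<chi> i j. A $ f i $ f j)"


definition pure_concurrence :: "complex^('m::finite \<times> 'n::finite) \<Rightarrow> real" where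
  "pure_concurrence \<psi> =
     (let r = ptrace_snd (ketbra \<psi>) in sqrt (2 * (1 - Re (trace (r ** r)))))"

definition pure_decomposition ::
  "'n::finite cmat \<Rightarrow> nat \<Rightarrow> (nat \<Rightarrow> real) \<Rightarrow> (nat \<Rightarrow> complex^'n) \<Rightarrow> bool" where
  "pure_decomposition \<rho> n p \<psi> \<longleftrightarrow>
     (\<forall>i<n. 0 \<le> p i \<and> norm (\<psi> i) = 1) \<and> (\<Sum>i<n. p i) = 1 \<and>
     \<rho> = (\<Sum>i<n. p i *\<^sub>R ketbra (\<psi> i))"

text \<open>For a density operator the set below is nonempty (spectral decomposition) and bounded below
  by 0, and its infimum is attained (the length of the decompositions can be bounded by a
  Caratheodory argument, and the pure concurrence is continuous), so the infimum is the minimum over all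
  decompositions.\<close>

definition concurrence :: "('m::finite \<times> 'n::finite) cmat \<Rightarrow> real" where
  "concurrence \<rho> =
     Inf {\<Sum>i<n. p i * pure_concurrence (\<psi> i) | n p \<psi>. pure_decomposition \<rho> n p \<psi>}"


text \<open>Each laboratory holds its qubits together with a local ancilla of arbitrary finite dimension
  (index types \<open>'a\<close>, \<open>'s\<close>, \<open>'b\<close>; a one-element type means no ancilla). An ancilla
  used in any round is present from the start and is kept to the end, where it is traced out.\<close>

type_synonym 'a alice = "2 \<times> 'a"  \<comment> \<open>qubit 1, ancilla\<close>
type_synonym 's sapna = "(2 \<times> 2) \<times> 's"  \<comment> \<open>qubits 2 and 3, ancilla\<close>
type_synonym 'b bob = "2 \<times> 'b"  \<comment> \<open>qubit 4, ancilla\<close>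
type_synonym ('a, 's, 'b) total = "'a alice \<times> 's sapna \<times> 'b bob"

text \<open>A round consists of the number \<open>n\<close> of results, the Kraus operators \<open>M i\<close>, and the rest of the
  protocol after result \<open>i\<close>, for \<open>i < n\<close>. Values at \<open>i \<ge> n\<close> are never used.\<close>

datatype ('a::finite, 's::finite, 'b::finite) protocol =
    Stop
  | Alice nat "nat \<Rightarrow> 'a alice cmat" "nat \<Rightarrow> ('a, 's, 'b) protocol"
  | Sapna nat "nat \<Rightarrow> 's sapna cmat" "nat \<Rightarrow> ('a, 's, 'b) protocol"
  | Bob nat "nat \<Rightarrow> 'b bob cmat" "nat \<Rightarrow> ('a, 's, 'b) protocol"

definition measurement :: "nat \<Rightarrow> (nat \<Rightarrow> 'n::finite cmat) \<Rightarrow> bool" where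
  "measurement n M \<longleftrightarrow> (\<Sum>i<n. dagger (M i) ** M i) = mat 1"

primrec locc :: "('a::finite, 's::finite, 'b::finite) protocol \<Rightarrow> bool" where
  "locc Stop \<longleftrightarrow> True"
| "locc (Alice n M P) \<longleftrightarrow> measurement n M \<and> (\<forall>i<n. locc (P i))"
| "locc (Sapna n M P) \<longleftrightarrow> measurement n M \<and> (\<forall>i<n. locc (P i))"
| "locc (Bob n M P) \<longleftrightarrow> measurement n M \<and> (\<forall>i<n. locc (P i))"

definition sandwich :: "'n::finite cmat \<Rightarrow> 'n cmat \<Rightarrow> 'n cmat" where
  "sandwich K \<tau> = K ** \<tau> ** dagger K"

text \<open>The unnormalized final states, one for each complete record of measurement results; the trace
  of each is the probability of that record.\<close>

primrec branches ::
  "('a::finite, 's::finite, 'b::finite) protocol \<Rightarrow> ('a, 's, 'b) total cmat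
     \<Rightarrow> ('a, 's, 'b) total cmat list" where
  "branches Stop \<tau> = [\<tau>]"
| "branches (Alice n M P) \<tau> =
     concat (map (\<lambda>i. branches (P i) (sandwich (M i \<otimes> mat 1 \<otimes> mat 1) \<tau>)) [0..<n])"
| "branches (Sapna n M P) \<tau> =
     concat (map (\<lambda>i. branches (P i) (sandwich (mat 1 \<otimes> M i \<otimes> mat 1) \<tau>)) [0..<n])"
| "branches (Bob n M P) \<tau> =
     concat (map (\<lambda>i. branches (P i) (sandwich (mat 1 \<otimes> mat 1 \<otimes> M i) \<tau>)) [0..<n])"

definition initial_state ::
  "(2 \<times> 2) cmat \<Rightarrow> (2 \<times> 2) cmat \<Rightarrow> 'a::finite cmat \<Rightarrow> 's::finite cmat \<Rightarrow> 'b::finite cmat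
     \<Rightarrow> ('a, 's, 'b) total cmat" where
  "initial_state \<rho>12 \<rho>34 \<alpha> \<gamma> \<beta> =
     reindex (\<lambda>((q1, a), ((q2, q3), s), (q4, b)). (((q1, q2), (q3, q4)), (a, s, b)))
       ((\<rho>12 \<otimes> \<rho>34) \<otimes> (\<alpha> \<otimes> \<gamma> \<otimes> \<beta>))"

definition reduce14 :: "('a::finite, 's::finite, 'b::finite) total cmat \<Rightarrow> (2 \<times> 2) cmat" where
  "reduce14 \<sigma> =
     ptrace_snd (reindex (\<lambda>((q1, q4), ((q2, q3), (a, s, b))). ((q1, a), ((q2, q3), s), (q4, b))) \<sigma>)"

text \<open>The pairs of \<open>Q\<^sub>j\<close> and the normalized reduced state on qubits 1 and 4. A record of probability 0
  gets the zero matrix as its state (division by zero), and its weight \<open>Q\<^sub>j = 0\<close> removes it from every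
  average.\<close>

definition outcomes ::
  "('a::finite, 's::finite, 'b::finite) protocol \<Rightarrow> ('a, 's, 'b) total cmat
     \<Rightarrow> (real \<times> (2 \<times> 2) cmat) list" where
  "outcomes P \<tau> =
     map (\<lambda>\<sigma>. let Q = Re (trace \<sigma>) in (Q, reduce14 ((1 / Q) *\<^sub>R \<sigma>))) (branches P \<tau>)"

end

theory Submission
  imports Defs
begin

text \<open>
  Write each initial state as a sum of rank-one matrices of unnormalized kets. After a branch with
  product Kraus operator \<open>A \<otimes> S \<otimes> B\<close>, fixing the basis indices of everything but qubits 1 and 4 leaves
  the ket with coefficient matrix \<open>F \<psi> G \<phi> H\<^sup>T\<close>, where \<open>F\<close>, \<open>G\<close>, \<open>H\<close> are \<open>2 \<times> 2\<close> matrices of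
  amplitudes of \<open>A\<close>, \<open>S\<close>, \<open>B\<close>. The unnormalized concurrence of a two-qubit ket is twice the modulus of
  the determinant of its coefficient matrix, so it factors here, and \<open>2 |det F| \<le> \<parallel>F\<parallel>\<^sup>2\<close> bounds the
  contribution of the branch by \<open>C\<^sub>1\<^sub>2 C\<^sub>3\<^sub>4 / 16\<close> times a product of squared Frobenius norms. Summed over
  all branches these products are conserved by every local measurement, so their total keeps its
  initial value, which is \<open>dim A \<cdot> dim S \<cdot> dim B = 2 \<cdot> 4 \<cdot> 2 = 16\<close>, the ancillas not being counted.
\<close>

section \<open>Matrix algebra\<close>

lemma dagger_mult: "dagger (A ** B) = dagger B ** dagger A"
  by (simp add: dagger_def matrix_matrix_mult_def vec_eq_iff mult.commute)

lemma dagger_mat_1 [simp]: "dagger (mat 1) = mat 1"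
  by (auto simp: dagger_def mat_def vec_eq_iff)

lemma sandwich_mult: "sandwich (A ** B) \<tau> = sandwich A (sandwich B \<tau>)"
  by (simp add: sandwich_def dagger_mult matrix_mul_assoc)

lemma sandwich_mat_1 [simp]: "sandwich (mat 1) \<tau> = \<tau>"
  by (simp add: sandwich_def)

lemma sum_UNIV_prod:
  "(\<Sum>z\<in>UNIV. f z) = (\<Sum>x\<in>UNIV. \<Sum>y\<in>UNIV. f (x :: 'a::finite, y :: 'b::finite))"
  by (simp add: sum.cartesian_product flip: UNIV_Times_UNIV)

lemma tensor_mult: "(A \<otimes> B) ** (C \<otimes> D) = (A ** C) \<otimes> (B ** D)"
  by (simp add: tensor_def matrix_matrix_mult_def vec_eq_iff sum_UNIV_prod sum_product mult_ac)

lemma tensor_mat_1 [simp]: "mat 1 \<otimes> mat 1 = mat 1"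
  by (auto simp: tensor_def mat_def vec_eq_iff prod_eq_iff)

section \<open>Kets and rank-one matrices under the matrix operations\<close>

definition tensor_vec :: "complex^'m::finite \<Rightarrow> complex^'n::finite \<Rightarrow> complex^('m \<times> 'n)" where
  "tensor_vec u v = (\<chi> i. u $ fst i * v $ snd i)"

lemma tensor_mult_vec: "(A \<otimes> B) *v tensor_vec u v = tensor_vec (A *v u) (B *v v)"
  by (simp add: tensor_def tensor_vec_def matrix_vector_mult_def vec_eq_iff sum_UNIV_prod
      sum_product mult_ac)

lemma ketbra_tensor: "ketbra u \<otimes> ketbra v = ketbra (tensor_vec u v)"
  by (simp add: ketbra_def tensor_def tensor_vec_def vec_eq_iff mult_ac)

lemma tensor_sum:
  "(\<Sum>i\<in>I. A i) \<otimes> (\<Sum>j\<in>J. B j) = (\<Sum>(i, j)\<in>I \<times> J. A i \<otimes> B j)"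
  by (simp add: tensor_def vec_eq_iff sum_product sum.cartesian_product case_prod_beta)

lemma reindex_sum: "reindex f (\<Sum>i\<in>I. A i) = (\<Sum>i\<in>I. reindex f (A i))"
  by (simp add: reindex_def vec_eq_iff)

lemma reindex_ketbra: "reindex f (ketbra v) = ketbra (\<chi> i. v $ f i)"
  by (simp add: reindex_def ketbra_def vec_eq_iff)

lemma ptrace_snd_sum: "ptrace_snd (\<Sum>i\<in>I. A i) = (\<Sum>i\<in>I. ptrace_snd (A i))"
  by (simp add: ptrace_snd_def vec_eq_iff sum.swap[of _ I UNIV])

lemma ptrace_snd_ketbra: "ptrace_snd (ketbra v) = (\<Sum>k\<in>UNIV. ketbra (\<chi> i. v $ (i, k)))"
  by (simp add: ptrace_snd_def ketbra_def vec_eq_iff)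

lemma matrix_mult_sum_right: "A ** (\<Sum>i\<in>I. B i) = (\<Sum>i\<in>I. A ** B i)"
  for A :: "complex^'n::finite^'m::finite"
  by (simp add: matrix_matrix_mult_def vec_eq_iff sum_distrib_left sum.swap[of _ I UNIV])

lemma matrix_mult_sum_left: "(\<Sum>i\<in>I. B i) ** A = (\<Sum>i\<in>I. B i ** A)"
  for A :: "complex^'n::finite^'m::finite"
  by (simp add: matrix_matrix_mult_def vec_eq_iff sum_distrib_right sum.swap[of _ I UNIV])

lemma sandwich_sum: "sandwich K (\<Sum>i\<in>I. A i) = (\<Sum>i\<in>I. sandwich K (A i))"
  by (simp add: sandwich_def matrix_mult_sum_right matrix_mult_sum_left)

lemma sandwich_ketbra: "sandwich K (ketbra v) = ketbra (K *v v)"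
proof -
  have "K ** ketbra v = (\<chi> i j. (K *v v) $ i * cnj (v $ j))"
    by (simp add: ketbra_def matrix_matrix_mult_def matrix_vector_mult_def vec_eq_iff
        sum_distrib_left mult_ac)
  thus ?thesis
    by (simp add: sandwich_def, simp add: ketbra_def matrix_matrix_mult_def
        matrix_vector_mult_def vec_eq_iff dagger_def sum_distrib_left mult_ac)
qed

lemma ketbra_scaleR: "ketbra (c *\<^sub>R v) = (c\<^sup>2) *\<^sub>R ketbra v"
  by (simp add: ketbra_def vec_eq_iff power2_eq_square)

lemma norm_vec_power2: "(norm v)\<^sup>2 = (\<Sum>i\<in>UNIV. (cmod (v $ i))\<^sup>2)"
  by (simp add: norm_vec_def L2_set_def sum_nonneg)

section \<open>Traces and measurements\<close>

lemma trace_sum: "trace (\<Sum>i\<in>I. A i) = (\<Sum>i\<in>I. trace (A i))"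
  for A :: "'i \<Rightarrow> complex^'n::finite^'n"
  by (simp add: trace_def sum.swap[of _ I UNIV])

lemma trace_ketbra: "trace (ketbra v) = of_real ((norm v)\<^sup>2)"
  by (simp add: trace_def ketbra_def norm_vec_power2 flip: complex_norm_square)

lemma trace_tensor: "trace (A \<otimes> B) = trace A * trace B"
  by (simp add: trace_def tensor_def sum_UNIV_prod sum_product)

lemma trace_ptrace_snd: "trace (ptrace_snd A) = trace A"
  by (simp add: trace_def ptrace_snd_def sum_UNIV_prod)

lemma trace_reindex: "bij f \<Longrightarrow> trace (reindex f A) = trace A"
  by (simp add: trace_def reindex_def sum.reindex_bij_betw[of f UNIV UNIV "\<lambda>i. A $ i $ i"])

text \<open>Cyclicity of the trace brings \<open>dagger (M i)\<close> next to \<open>M i\<close>,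
  where completeness applies. As \<open>\<tau>\<close> is any matrix, the operators behind
  \<open>weight\<close>, which are not states, are covered.\<close>

lemma measurement_trace:
  assumes "measurement n M"
  shows "(\<Sum>i<n. trace (sandwich (M i) \<tau>)) = trace \<tau>"
proof -
  have "(\<Sum>i<n. trace (sandwich (M i) \<tau>)) = (\<Sum>i<n. trace ((dagger (M i) ** M i) ** \<tau>))"
    by (intro sum.cong refl) (metis matrix_mul_assoc sandwich_def trace_mul_sym)
  also have "\<dots> = trace ((\<Sum>i<n. dagger (M i) ** M i) ** \<tau>)"
    by (simp add: matrix_mult_sum_left trace_sum)
  finally show ?thesis
    using assms by (simp add: measurement_def)
qed

section \<open>Positive semidefinite matrices as sums of rank-one matrices\<close>

lemma cinner_axis: "cinner (axis i c) v = cnj c * v $ i"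
proof -
  have "cinner (axis i c) v = (\<Sum>j\<in>UNIV. if j = i then cnj c * v $ j else 0)"
    unfolding cinner_def axis_def by (intro sum.cong) auto
  thus ?thesis by simp
qed

lemma cinner_add_left: "cinner (x + y) z = cinner x z + cinner y z"
  by (simp add: cinner_def algebra_simps sum.distrib)

lemma cinner_add_right: "cinner x (y + z) = cinner x y + cinner x z"
  by (simp add: cinner_def algebra_simps sum.distrib)

lemma cinner_hermitian:
  assumes "dagger A = A"
  shows "cinner x (A *v y) = cnj (cinner y (A *v x))"
proof -
  have A: "cnj (A $ i $ j) = A $ j $ i" for i j
    using assms by (simp add: dagger_def vec_eq_iff)
  have "cinner x (A *v y) = (\<Sum>i\<in>UNIV. \<Sum>j\<in>UNIV. cnj (x $ i) * A $ i $ j * y $ j)"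
    by (simp add: cinner_def matrix_vector_mult_def sum_distrib_left mult_ac)
  also have "\<dots> = (\<Sum>j\<in>UNIV. \<Sum>i\<in>UNIV. cnj (x $ i) * A $ i $ j * y $ j)"
    by (rule sum.swap)
  also have "\<dots> = cnj (cinner y (A *v x))"
    by (simp add: cinner_def matrix_vector_mult_def sum_distrib_left mult_ac A)
  finally show ?thesis .
qed

lemma matrix_mult_axis: "(A *v axis j c) $ i = A $ i $ j * c" for c :: complex
proof -
  have "(A *v axis j c) $ i = (\<Sum>k\<in>UNIV. if k = j then A $ i $ k * c else 0)"
    unfolding matrix_vector_mult_def axis_def vec_lambda_beta by (intro sum.cong) auto
  thus ?thesis by simp
qed

text \<open>The form as a function of one coordinate; both positivity arguments below choose
  \<open>c\<close> to make it small.\<close>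

lemma hermitian_form_shift:
  assumes "dagger A = A"
  shows "Re (cinner (x + axis i c) (A *v (x + axis i c)))
    = Re (cinner x (A *v x)) + 2 * Re (cnj c * (A *v x) $ i) + (cmod c)\<^sup>2 * Re (A $ i $ i)"
proof -
  have *: "cinner x (A *v axis i c) = cnj (cnj c * (A *v x) $ i)"
    by (subst cinner_hermitian[OF assms]) (simp add: cinner_axis)
  have "Re (cnj c * (A $ i $ i * c)) = (cmod c)\<^sup>2 * Re (A $ i $ i)"
    unfolding cmod_power2 by (simp add: power2_eq_square algebra_simps)
  with * show ?thesis
    by (simp add: matrix_vector_right_distrib cinner_add_left cinner_add_right cinner_axis
        matrix_mult_axis)
qed

lemma psd_diag:
  assumes "psd A" shows "0 \<le> Re (A $ i $ i)"
proof -
  have "0 \<le> Re (cinner (axis i 1) (A *v axis i 1))"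
    using assms by (simp add: psd_def)
  thus ?thesis by (simp add: cinner_axis matrix_mult_axis)
qed

lemma hermitian_diag:
  assumes "dagger A = A" shows "A $ i $ i = of_real (Re (A $ i $ i))"
proof -
  have "cnj (A $ i $ i) = A $ i $ i"
    using arg_cong[OF assms, of "\<lambda>B. B $ i $ i"] by (simp add: dagger_def)
  thus ?thesis by (auto simp: complex_eq_iff)
qed

lemma psd_zero_diag:
  assumes "psd A" "\<And>i. A $ i $ i = 0"
  shows "A = 0"
proof -
  have herm: "dagger A = A" using assms(1) by (simp add: psd_def)
  have "A $ i $ j = 0" for i j
  proof -
    \<comment> \<open>With zero diagonal the form is real-linear in the shift, so a shift against
      \<open>A $ i $ j\<close> makes it negative unless that entry vanishes.\<close>
    have "0 \<le> Re (cinner (axis j 1 + axis i (- A $ i $ j)) (A *v (axis j 1 + axis i (- A $ i $ j))))"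
      using assms(1) by (simp add: psd_def)
    also have "\<dots> = - 2 * (cmod (A $ i $ j))\<^sup>2"
      unfolding hermitian_form_shift[OF herm] cinner_axis matrix_mult_axis cmod_power2
      by (simp add: assms(2) power2_eq_square algebra_simps)
    finally show ?thesis by simp
  qed
  thus ?thesis by (simp add: vec_eq_iff)
qed

lemma cinner_ketbra: "cinner x (ketbra v *v x) = of_real ((cmod (cinner v x))\<^sup>2)"
proof -
  have "cinner x (ketbra v *v x) = (\<Sum>i\<in>UNIV. \<Sum>j\<in>UNIV. cnj (x $ i) * v $ i * (cnj (v $ j) * x $ j))"
    by (simp add: cinner_def ketbra_def matrix_vector_mult_def sum_distrib_left mult_ac)
  also have "\<dots> = cnj (cinner v x) * cinner v x"
    by (simp add: cinner_def sum_product mult_ac)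
  finally show ?thesis
    using complex_norm_square[of "cinner v x"] by (simp add: mult.commute)
qed

text \<open>One Cholesky step: \<open>ketbra v\<close> agrees with \<open>A\<close> in row and
  column \<open>k\<close>, and the remainder is the Schur complement of the pivot. The third claim
  preserves diagonal zeros, so that elimination terminates.\<close>

lemma psd_schur_complement:
  fixes A :: "'n::finite cmat"
  assumes "psd A" "A $ k $ k \<noteq> 0"
  defines "v \<equiv> (1 / sqrt (Re (A $ k $ k))) *\<^sub>R column k A"
  shows "psd (A - ketbra v)" "(A - ketbra v) $ k $ k = 0"
    "A $ i $ i = 0 \<Longrightarrow> (A - ketbra v) $ i $ i = 0"
proof -
  define d where "d = Re (A $ k $ k)"
  have herm: "dagger A = A" using assms(1) by (simp add: psd_def)
  have Akk: "A $ k $ k = of_real d" unfolding d_def by (rule hermitian_diag[OF herm])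
  have d: "d > 0"
    using psd_diag[OF assms(1), of k] assms(2) by (cases "d = 0") (simp_all add: Akk)
  have cnjA: "cnj (A $ i $ j) = A $ j $ i" for i j
    using herm by (simp add: dagger_def vec_eq_iff)
  have kb: "ketbra v $ i $ j = A $ i $ k * A $ k $ j / of_real d" for i j
  proof -
    have *: "ketbra v = (1 / d) *\<^sub>R ketbra (column k A)"
      using d by (simp add: v_def ketbra_scaleR power_divide flip: d_def)
    show ?thesis
      unfolding * by (simp add: ketbra_def column_def cnjA scaleR_conv_of_real[where 'a = complex])
  qed
  have herm': "dagger (A - ketbra v) = A - ketbra v"
    by (simp add: dagger_def vec_eq_iff cnjA kb mult.commute)
  have "0 \<le> Re (cinner x ((A - ketbra v) *v x))" for x
  proof -
    define z where "z = (A *v x) $ k"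
    have "cinner v x = z / sqrt d"
      by (simp add: v_def cinner_def column_def z_def matrix_vector_mult_def cnjA d_def
          sum_divide_distrib scaleR_conv_of_real[where 'a = complex])
    hence cv: "(cmod (cinner v x))\<^sup>2 = (cmod z)\<^sup>2 / d"
      using d by (simp add: norm_divide power_divide)
    \<comment> \<open>Completing the square: this shift minimizes the form of \<open>A\<close> along
      coordinate \<open>k\<close>, and the minimum is the form of \<open>A - ketbra v\<close> at
      \<open>x\<close>.\<close>
    have "0 \<le> Re (cinner (x + axis k (- z / d)) (A *v (x + axis k (- z / d))))"
      using assms(1) by (simp add: psd_def)
    also have "\<dots> = Re (cinner x (A *v x)) - (cmod z)\<^sup>2 / d"
      using d by (subst hermitian_form_shift[OF herm])
        (simp add: Akk norm_divide power_divide cmod_power2 flip: z_def,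
         simp add: power2_eq_square field_simps)
    also have "\<dots> = Re (cinner x (A *v x) - cinner x (ketbra v *v x))"
      by (simp add: cinner_ketbra cv)
    also have "cinner x (A *v x) - cinner x (ketbra v *v x) = cinner x ((A - ketbra v) *v x)"
      by (simp add: cinner_def matrix_vector_mult_def algebra_simps sum_subtractf)
    finally show ?thesis .
  qed
  with herm' show psd: "psd (A - ketbra v)" by (simp add: psd_def)
  show "(A - ketbra v) $ k $ k = 0" using d by (simp add: kb Akk)
  show "(A - ketbra v) $ i $ i = 0" if "A $ i $ i = 0"
  proof -
    have "A $ i $ k * A $ k $ i = of_real ((cmod (A $ i $ k))\<^sup>2)"
      using complex_norm_square[of "A $ i $ k"] cnjA[of i k] by simp
    \<comment> \<open>The new entry is minus a square over the pivot, while positivity makes it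
      nonnegative.\<close>
    hence "(A - ketbra v) $ i $ i = of_real (- ((cmod (A $ i $ k))\<^sup>2 / d))"
      using that by (simp add: kb)
    moreover have "0 \<le> Re ((A - ketbra v) $ i $ i)" by (rule psd_diag[OF psd])
    moreover have "0 \<le> (cmod (A $ i $ k))\<^sup>2 / d" using d by simp
    ultimately show ?thesis by simp
  qed
qed

text \<open>Cholesky elimination replaces the spectral theorem: each step clears a nonzero diagonal
  entry and creates none, and zero diagonal forces the zero matrix. The kets need be neither
  normalized nor orthogonal.\<close>

lemma psd_sum_ketbra:
  fixes A :: "'n::finite cmat"
  assumes "psd A"
  shows "\<exists>n v. A = (\<Sum>i<(n::nat). ketbra (v i))"
  using assms
proof (induction "card {i. A $ i $ i \<noteq> 0}" arbitrary: A rule: less_induct)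
  case less
  show ?case
  proof (cases "\<exists>k. A $ k $ k \<noteq> 0")
    case False
    hence "A = (\<Sum>i<(0::nat). ketbra (undefined i))"
      using psd_zero_diag[OF less.prems] by simp
    thus ?thesis by (intro exI)
  next
    case True
    then obtain k where k: "A $ k $ k \<noteq> 0" by blast
    define u where "u = (1 / sqrt (Re (A $ k $ k))) *\<^sub>R column k A"
    note schur = psd_schur_complement[OF less.prems k, folded u_def]
    have "{i. (A - ketbra u) $ i $ i \<noteq> 0} \<subset> {i. A $ i $ i \<noteq> 0}"
      using schur(2,3) k by blast
    hence "card {i. (A - ketbra u) $ i $ i \<noteq> 0} < card {i. A $ i $ i \<noteq> 0}"
      by (intro psubset_card_mono) auto
    from less.hyps[OF this schur(1)] obtain n v
      where "A - ketbra u = (\<Sum>i<(n::nat). ketbra (v i))" by blast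
    hence "A = (\<Sum>i<Suc n. ketbra ((v(n := u)) i))"
      by (simp add: algebra_simps)
    thus ?thesis by blast
  qed
qed

section \<open>Concurrence of two qubits\<close>

text \<open>The ket is read as a 2 by 2 coefficient matrix. The modulus scales like the squared
  norm, which suits unnormalized kets.\<close>

definition vdet :: "complex^(2 \<times> 2) \<Rightarrow> complex" where
  "vdet v = v $ (1, 1) * v $ (2, 2) - v $ (1, 2) * v $ (2, 1)"

lemma vdet_scaleR: "vdet (c *\<^sub>R v) = (c\<^sup>2) *\<^sub>R vdet v"
  by (simp add: vdet_def power2_eq_square algebra_simps)

text \<open>The reduced state is the coefficient matrix times its adjoint, so its determinant is
  \<open>(cmod (vdet \<psi>))\<^sup>2\<close>; for a 2 by 2 matrix \<open>r\<close> of trace one,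
  \<open>1 - trace (r ** r)\<close> is twice the determinant.\<close>

lemma pure_concurrence_eq_vdet:
  assumes "norm \<psi> = 1"
  shows "pure_concurrence \<psi> = 2 * cmod (vdet \<psi>)"
proof -
  define a b c d where "a = \<psi> $ (1, 1)" and "b = \<psi> $ (1, 2)"
    and "c = \<psi> $ (2, 1)" and "d = \<psi> $ (2, 2)"
  note abcd = a_def b_def c_def d_def
  define r where "r = ptrace_snd (ketbra \<psi>)"
  have "(norm \<psi>)\<^sup>2 = (cmod a)\<^sup>2 + (cmod b)\<^sup>2 + (cmod c)\<^sup>2 + (cmod d)\<^sup>2"
    by (simp add: norm_vec_power2 sum_UNIV_prod sum_2 abcd)
  hence one: "(cmod a)\<^sup>2 + (cmod b)\<^sup>2 + (cmod c)\<^sup>2 + (cmod d)\<^sup>2 = 1"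
    using assms by simp
  have "trace (r ** r) = (a * cnj a + b * cnj b)\<^sup>2 + (c * cnj c + d * cnj d)\<^sup>2
      + 2 * ((a * cnj c + b * cnj d) * (c * cnj a + d * cnj b))"
    by (simp add: trace_def matrix_matrix_mult_def r_def ptrace_snd_def ketbra_def sum_2
        power2_eq_square mult_ac flip: abcd)
  \<comment> \<open>Lagrange's identity for the rows \<open>(a, b)\<close> and
    \<open>(c, d)\<close>.\<close>
  hence "Re (trace (r ** r)) = ((cmod a)\<^sup>2 + (cmod b)\<^sup>2 + (cmod c)\<^sup>2 + (cmod d)\<^sup>2)\<^sup>2
      - 2 * (cmod (a * d - b * c))\<^sup>2"
    unfolding cmod_power2 by (simp add: power2_eq_square algebra_simps)
  hence "2 * (1 - Re (trace (r ** r))) = (2 * cmod (vdet \<psi>))\<^sup>2"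
    by (simp add: one vdet_def power_mult_distrib flip: abcd)
  thus ?thesis
    unfolding pure_concurrence_def Let_def r_def[symmetric] by (simp add: real_sqrt_mult)
qed

text \<open>The squared norm of a ket, over \<open>Q\<close>, becomes its probability; it cancels in
  the average because \<open>vdet\<close> is homogeneous of degree two.\<close>

lemma pure_decomposition_normalize:
  assumes "finite I" and \<rho>: "\<rho> = (\<Sum>i\<in>I. ketbra (v i))"
    and Q: "Q = Re (trace \<rho>)" "Q > 0"
  obtains n p \<psi> where "pure_decomposition ((1 / Q) *\<^sub>R \<rho>) n p \<psi>"
    "Q * (\<Sum>i<n. p i * pure_concurrence (\<psi> i)) = (\<Sum>i\<in>I. 2 * cmod (vdet (v i)))"
proof -
  \<comment> \<open>Zero kets cannot be normalized; they are dropped, and \<open>h\<close> renumbers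
    the rest.\<close>
  define J where "J = {i \<in> I. v i \<noteq> 0}"
  have J: "finite J" "J \<subseteq> I" using assms(1) by (auto simp: J_def)
  then obtain h where h: "bij_betw h {..<card J} J"
    using ex_bij_betw_nat_finite[of J] by (auto simp: atLeast0LessThan)
  have hJ: "v (h i) \<noteq> 0" if "i < card J" for i
    using bij_betwE[OF h] that by (auto simp: J_def)
  define p where "p i = (norm (v (h i)))\<^sup>2 / Q" for i
  define \<psi> where "\<psi> i = (1 / norm (v (h i))) *\<^sub>R v (h i)" for i
  have reh: "(\<Sum>i<card J. f (h i)) = (\<Sum>j\<in>I. f j)"
    if "\<And>j. j \<in> I - J \<Longrightarrow> f j = 0" for f :: "_ \<Rightarrow> 'c::comm_monoid_add"
  proof -
    have "(\<Sum>i<card J. f (h i)) = (\<Sum>j\<in>J. f j)" by (rule sum.reindex_bij_betw[OF h])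
    also have "\<dots> = (\<Sum>j\<in>I. f j)"
      using J that assms(1) by (intro sum.mono_neutral_left) auto
    finally show ?thesis .
  qed
  have v0: "v j = 0" if "j \<in> I - J" for j using that by (auto simp: J_def)
  have norm1: "norm (\<psi> i) = 1" if "i < card J" for i using hJ[OF that] by (simp add: \<psi>_def)
  have Qn: "Q = (\<Sum>j\<in>I. (norm (v j))\<^sup>2)"
    by (simp add: Q \<rho> trace_sum trace_ketbra)
  have "(\<Sum>i<card J. p i) = (\<Sum>i<card J. (norm (v (h i)))\<^sup>2) / Q"
    by (simp add: p_def sum_divide_distrib)
  also have "\<dots> = 1"
    using Q(2) by (subst reh[of "\<lambda>j. (norm (v j))\<^sup>2"]) (auto simp: v0 simp flip: Qn)
  finally have sum1: "(\<Sum>i<card J. p i) = 1" .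
  have "(\<Sum>i<card J. p i *\<^sub>R ketbra (\<psi> i)) = (\<Sum>i<card J. (1 / Q) *\<^sub>R ketbra (v (h i)))"
    using hJ by (intro sum.cong refl) (simp add: p_def \<psi>_def ketbra_scaleR power_divide)
  also have "\<dots> = (1 / Q) *\<^sub>R \<rho>"
    unfolding \<rho> scaleR_sum_right by (rule reh) (simp add: v0 ketbra_def vec_eq_iff)
  finally have "pure_decomposition ((1 / Q) *\<^sub>R \<rho>) (card J) p \<psi>"
    using norm1 sum1 Q(2) by (simp add: pure_decomposition_def p_def)
  moreover have "Q * (\<Sum>i<card J. p i * pure_concurrence (\<psi> i)) = (\<Sum>i\<in>I. 2 * cmod (vdet (v i)))"
  proof -
    have "Q * (\<Sum>i<card J. p i * pure_concurrence (\<psi> i))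
        = (\<Sum>i<card J. 2 * cmod (vdet (v (h i))))"
      unfolding sum_distrib_left
    proof (intro sum.cong refl)
      fix i assume "i \<in> {..<card J}"
      hence i: "i < card J" by simp
      have "vdet (\<psi> i) = (1 / (norm (v (h i)))\<^sup>2) *\<^sub>R vdet (v (h i))"
        by (simp add: \<psi>_def vdet_scaleR power_divide)
      thus "Q * (p i * pure_concurrence (\<psi> i)) = 2 * cmod (vdet (v (h i)))"
        using hJ[OF i] Q(2) by (simp add: pure_concurrence_eq_vdet[OF norm1[OF i]] p_def)
    qed
    also have "\<dots> = (\<Sum>i\<in>I. 2 * cmod (vdet (v i)))"
      by (rule reh) (simp add: v0 vdet_def)
    finally show ?thesis .
  qed
  ultimately show ?thesis using that by blast
qed

section \<open>Mixed-state concurrence bounded by unnormalized ensembles\<close>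

lemma average_nonneg:
  assumes "pure_decomposition \<rho> n p (\<psi> :: nat \<Rightarrow> complex^(2 \<times> 2))"
  shows "0 \<le> (\<Sum>i<n. p i * pure_concurrence (\<psi> i))"
  using assms by (intro sum_nonneg mult_nonneg_nonneg)
    (auto simp: pure_decomposition_def pure_concurrence_eq_vdet)

lemma concurrence_le_average:
  fixes \<rho> :: "(2 \<times> 2) cmat"
  assumes "pure_decomposition \<rho> n p \<psi>"
  shows "concurrence \<rho> \<le> (\<Sum>i<n. p i * pure_concurrence (\<psi> i))"
  unfolding concurrence_def
  by (rule cInf_lower) (use assms average_nonneg in \<open>auto intro!: bdd_belowI[of _ 0]\<close>)

text \<open>The rescaled ensemble is one competitor in the infimum.\<close>

lemma concurrence_le_sum_vdet:
  assumes "finite I" "\<rho> = (\<Sum>i\<in>I. ketbra (v i))" "Q = Re (trace \<rho>)"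
  shows "Q * concurrence ((1 / Q) *\<^sub>R \<rho>) \<le> (\<Sum>i\<in>I. 2 * cmod (vdet (v i)))"
proof (cases "Q > 0")
  case True
  obtain n p \<psi> where d: "pure_decomposition ((1 / Q) *\<^sub>R \<rho>) n p \<psi>"
    and *: "Q * (\<Sum>i<n. p i * pure_concurrence (\<psi> i)) = (\<Sum>i\<in>I. 2 * cmod (vdet (v i)))"
    using pure_decomposition_normalize[OF assms True] by metis
  have "Q * concurrence ((1 / Q) *\<^sub>R \<rho>) \<le> Q * (\<Sum>i<n. p i * pure_concurrence (\<psi> i))"
    using True concurrence_le_average[OF d] by simp
  with * show ?thesis by simp
next
  case False
  have "Q = (\<Sum>j\<in>I. (norm (v j))\<^sup>2)"
    by (simp add: assms trace_sum trace_ketbra)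
  \<comment> \<open>Here \<open>concurrence\<close> is taken at the zero matrix, which has no
    decomposition; the factor \<open>Q = 0\<close> removes the value of that empty infimum.\<close>
  with False have "Q = 0" using sum_nonneg[of I "\<lambda>j. (norm (v j))\<^sup>2"] by simp
  thus ?thesis by (simp add: sum_nonneg)
qed

text \<open>A bound valid for every unnormalized ensemble passes to the infimum. The factor
  \<open>c\<close> permits two successive applications to a product of concurrences.\<close>

lemma le_concurrence:
  fixes \<rho> :: "(2 \<times> 2) cmat"
  assumes "density_operator \<rho>" "0 \<le> c"
    and le: "\<And>n v. \<rho> = (\<Sum>i<(n::nat). ketbra (v i)) \<Longrightarrow> y \<le> c * (\<Sum>i<n. 2 * cmod (vdet (v i)))"
  shows "y \<le> c * concurrence \<rho>"
proof -
  obtain n v where v: "\<rho> = (\<Sum>i<(n::nat). ketbra (v i))"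
    using psd_sum_ketbra assms(1) unfolding density_operator_def by metis
  show ?thesis
  proof (cases "c = 0")
    \<comment> \<open>The claim is \<open>y \<le> 0\<close>, and any single ensemble yields
      it.\<close>
    case True
    thus ?thesis using le[OF v] by simp
  next
    case False
    hence c: "c > 0" using assms(2) by simp
    have "y / c \<le> concurrence \<rho>"
      unfolding concurrence_def
    proof (rule cInf_greatest)
      have "\<exists>n p \<psi>. pure_decomposition ((1 / 1) *\<^sub>R \<rho>) n p \<psi>"
        using pure_decomposition_normalize[of "{..<n}" \<rho> v 1] v assms(1)
        unfolding density_operator_def by (metis finite_lessThan one_complex.sel(1) zero_less_one)
      thus "{\<Sum>i<n. p i * pure_concurrence (\<psi> i) | n p \<psi>. pure_decomposition \<rho> n p \<psi>} \<noteq> {}"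
        by auto
    next
      fix x assume "x \<in> {\<Sum>i<n. p i * pure_concurrence (\<psi> i) | n p \<psi>. pure_decomposition \<rho> n p \<psi>}"
      then obtain n p \<psi> where x: "x = (\<Sum>i<n. p i * pure_concurrence (\<psi> i))"
        and d: "pure_decomposition \<rho> n p \<psi>" by blast
      have p: "0 \<le> p i" "norm (\<psi> i) = 1" if "i < n" for i
        using d that by (auto simp: pure_decomposition_def)
      \<comment> \<open>Probabilities enter the kets as square roots, since \<open>ketbra\<close> is
        quadratic.\<close>
      have "\<rho> = (\<Sum>i<n. ketbra (sqrt (p i) *\<^sub>R \<psi> i))"
        using d by (auto simp: pure_decomposition_def ketbra_scaleR intro!: sum.cong)
      from le[OF this] have "y \<le> c * (\<Sum>i<n. 2 * cmod (vdet (sqrt (p i) *\<^sub>R \<psi> i)))" .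
      also have "(\<Sum>i<n. 2 * cmod (vdet (sqrt (p i) *\<^sub>R \<psi> i))) = x"
        unfolding x using p by (intro sum.cong refl) (simp add: vdet_scaleR pure_concurrence_eq_vdet)
      finally show "y / c \<le> x" using c by (simp add: field_simps)
    qed
    thus ?thesis using c by (simp add: field_simps)
  qed
qed

section \<open>Local amplitudes and weights\<close>

text \<open>The input ancilla is contracted with \<open>u\<close>, while \<open>r\<close> keeps
  qubit and ancilla indices, so that fixing the output ancilla leaves a small matrix.\<close>

definition amplitude ::
  "('k::finite \<times> 'a::finite) cmat \<Rightarrow> complex^'a \<Rightarrow> 'k \<times> 'a \<Rightarrow> 'k \<Rightarrow> complex" where
  "amplitude A u r p = (A *v tensor_vec (axis p 1) u) $ r"

text \<open>The squared Frobenius norm of \<open>A\<close> with the input ancilla averaged over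
  \<open>\<alpha>\<close>.\<close>

definition weight :: "('k::finite \<times> 'a::finite) cmat \<Rightarrow> 'a cmat \<Rightarrow> real" where
  "weight A \<alpha> = Re (trace (sandwich A (mat 1 \<otimes> \<alpha>)))"

lemma mat_1_eq_sum_ketbra: "(mat 1 :: 'k::finite cmat) = (\<Sum>p\<in>UNIV. ketbra (axis p 1))"
proof -
  have "(\<Sum>p\<in>UNIV. axis p (1::complex) $ i * cnj (axis p 1 $ j)) = (if i = j then 1 else 0)"
    for i j :: 'k
  proof -
    have "(\<Sum>p\<in>UNIV. axis p (1::complex) $ i * cnj (axis p 1 $ j))
        = (\<Sum>p\<in>UNIV. if p = i then (if i = j then 1 else 0) else 0)"
      by (intro sum.cong) (auto simp: axis_def)
    thus ?thesis by simp
  qed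
  thus ?thesis by (simp add: mat_def ketbra_def vec_eq_iff)
qed

text \<open>Links the trace form, conserved by measurements, to the amplitudes in the determinant
  bounds: both tensor factors split into rank-one matrices.\<close>

lemma weight_eq_sum_amplitude:
  fixes A :: "('k::finite \<times> 'a::finite) cmat"
  assumes "\<alpha> = (\<Sum>l\<in>I. ketbra (u l))"
  shows "weight A \<alpha> = (\<Sum>l\<in>I. \<Sum>p\<in>UNIV. \<Sum>r\<in>UNIV. (cmod (amplitude A (u l) r p))\<^sup>2)"
proof -
  have "sandwich A (mat 1 \<otimes> \<alpha>)
      = (\<Sum>(p, l)\<in>UNIV \<times> I. ketbra (A *v tensor_vec (axis p 1) (u l)))"
    unfolding assms mat_1_eq_sum_ketbra tensor_sum sandwich_sum
    by (simp add: ketbra_tensor sandwich_ketbra case_prod_beta)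
  also have "\<dots> = (\<Sum>p\<in>UNIV. \<Sum>l\<in>I. ketbra (A *v tensor_vec (axis p 1) (u l)))"
    by (rule sum.cartesian_product[symmetric])
  finally have "weight A \<alpha>
      = (\<Sum>p\<in>UNIV. \<Sum>l\<in>I. \<Sum>r\<in>UNIV. (cmod (amplitude A (u l) r p))\<^sup>2)"
    by (simp add: weight_def trace_sum trace_ketbra norm_vec_power2 amplitude_def)
  also have "\<dots> = (\<Sum>l\<in>I. \<Sum>p\<in>UNIV. \<Sum>r\<in>UNIV. (cmod (amplitude A (u l) r p))\<^sup>2)"
    by (rule sum.swap)
  finally show ?thesis .
qed

text \<open>The conservation law behind the induction on protocols: \<open>M i\<close> acts after
  \<open>A\<close>, hence as the outer conjugation.\<close>

lemma weight_measurement: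
  assumes "measurement n M"
  shows "(\<Sum>i<n. weight (M i ** A) \<alpha>) = weight A \<alpha>"
  by (simp add: weight_def sandwich_mult measurement_trace[OF assms] flip: Re_sum)

lemma weight_mat_1:
  assumes "density_operator \<alpha>"
  shows "weight (mat 1 :: ('k::finite \<times> 'a::finite) cmat) \<alpha> = CARD('k)"
  using assms by (simp add: weight_def trace_tensor density_operator_def trace_I)

section \<open>The final state of a single branch\<close>

definition det2 :: "(2 \<Rightarrow> 2 \<Rightarrow> complex) \<Rightarrow> complex" where
  "det2 F = F 1 1 * F 2 2 - F 1 2 * F 2 1"

text \<open>Triangle inequality, then \<open>2xy \<le> x\<^sup>2 + y\<^sup>2\<close>. This is the
  only loss in the bound for a slice.\<close>

lemma det2_le_norm: "2 * cmod (det2 F) \<le> (\<Sum>p\<in>UNIV. \<Sum>q\<in>UNIV. (cmod (F q p))\<^sup>2)"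
proof -
  have "2 * (x * y) \<le> x\<^sup>2 + y\<^sup>2" for x y :: real
    using sum_squares_bound[of x y] by (simp add: mult_ac)
  note this[of "cmod (F 1 1)" "cmod (F 2 2)"] this[of "cmod (F 1 2)" "cmod (F 2 1)"]
  moreover have "cmod (det2 F) \<le> cmod (F 1 1) * cmod (F 2 2) + cmod (F 1 2) * cmod (F 2 1)"
    unfolding det2_def by (metis norm_mult norm_triangle_ineq4)
  ultimately show ?thesis by (simp add: sum_2)
qed

text \<open>The coefficient matrix is a product of five matrices, and determinants multiply. Both
  indices of \<open>G\<close> are inputs: a row of Sapna's operator is a bra on qubits 2 and 3, read
  as a matrix joining \<open>\<psi>\<close> to \<open>\<phi>\<close>.\<close>

lemma vdet_product:
  "vdet (\<chi> i. \<Sum>p1\<in>UNIV. \<Sum>p2\<in>UNIV. \<Sum>p3\<in>UNIV. \<Sum>p4\<in>UNIV.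
      (\<psi> $ (p1, p2) * \<phi> $ (p3, p4)) * (F (fst i) p1 * (G p2 p3 * H (snd i) p4)))
   = det2 F * det2 G * det2 H * vdet \<psi> * vdet \<phi>" (is "vdet ?v = _")
proof -
  \<comment> \<open>\<open>mH\<close> is transposed because Bob's output must index the columns of
    the product.\<close>
  define mF mG mH m\<psi> m\<phi> :: "complex^2^2"
    where "mF = (\<chi> i j. F i j)" and "mG = (\<chi> i j. G i j)" and "mH = (\<chi> i j. H j i)"
      and "m\<psi> = (\<chi> i j. \<psi> $ (i, j))" and "m\<phi> = (\<chi> i j. \<phi> $ (i, j))"
  note defs = mF_def mG_def mH_def m\<psi>_def m\<phi>_def
  have "?v $ (i, j) = (mF ** (m\<psi> ** (mG ** (m\<phi> ** mH)))) $ i $ j" for i j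
    by (simp add: defs matrix_matrix_mult_def sum_distrib_left mult_ac)
  hence "vdet ?v = det (mF ** (m\<psi> ** (mG ** (m\<phi> ** mH))))"
    by (simp add: vdet_def det_2)
  also have "\<dots> = det2 F * det2 G * det2 H * vdet \<psi> * vdet \<phi>"
    unfolding det_mul by (simp add: det_2 defs det2_def vdet_def mult_ac)
  finally show ?thesis .
qed

text \<open>Factors are regrouped by laboratory: \<open>\<psi>\<close> spans Alice and Sapna,
  \<open>\<phi>\<close> spans Sapna and Bob.\<close>

definition initial_ket ::
  "complex^(2 \<times> 2) \<Rightarrow> complex^(2 \<times> 2) \<Rightarrow> complex^'a::finite \<Rightarrow> complex^'s::finite \<Rightarrow>
    complex^'b::finite \<Rightarrow> complex^('a alice \<times> 's sapna \<times> 'b bob)" where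
  "initial_ket \<psi> \<phi> a s b = (\<chi> i. case i of ((q1, x), ((q2, q3), y), (q4, z)) \<Rightarrow>
     \<psi> $ (q1, q2) * \<phi> $ (q3, q4) * (a $ x * (s $ y * b $ z)))"

lemma initial_state_eq_sum_ketbra:
  "initial_state (\<Sum>i\<in>I. ketbra (\<psi> i)) (\<Sum>k\<in>K. ketbra (\<phi> k))
     (\<Sum>l\<in>L. ketbra (a l)) (\<Sum>m\<in>M. ketbra (s m)) (\<Sum>n\<in>N. ketbra (b n))
   = (\<Sum>((i, k), (l, m, n))\<in>(I \<times> K) \<times> (L \<times> M \<times> N).
       ketbra (initial_ket (\<psi> i) (\<phi> k) (a l) (s m) (b n)))"
  unfolding initial_state_def tensor_sum reindex_sum
  by (intro sum.cong refl)
    (auto simp: reindex_def tensor_def ketbra_def initial_ket_def vec_eq_iff mult_ac)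

text \<open>Expanding \<open>\<psi>\<close> and \<open>\<phi>\<close> in the basis makes each term a
  product over the three laboratories, on which local operators act factorwise.\<close>

lemma initial_ket_expand:
  "initial_ket \<psi> \<phi> a s b = (\<Sum>p1\<in>UNIV. \<Sum>p2\<in>UNIV. \<Sum>p3\<in>UNIV. \<Sum>p4\<in>UNIV.
     (\<psi> $ (p1, p2) * \<phi> $ (p3, p4)) *s
       tensor_vec (tensor_vec (axis p1 1) a)
         (tensor_vec (tensor_vec (axis (p2, p3) 1) s) (tensor_vec (axis p4 1) b)))"
proof -
  have "initial_ket \<psi> \<phi> a s b $ ((q1, x), ((q2, q3), y), (q4, z))
     = (\<Sum>p1\<in>UNIV. \<Sum>p2\<in>UNIV. \<Sum>p3\<in>UNIV. \<Sum>p4\<in>UNIV.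
     (\<psi> $ (p1, p2) * \<phi> $ (p3, p4)) *s
       tensor_vec (tensor_vec (axis p1 1) a)
         (tensor_vec (tensor_vec (axis (p2, p3) 1) s) (tensor_vec (axis p4 1) b))) $
         ((q1, x), ((q2, q3), y), (q4, z))" for q1 x q2 q3 y q4 z
    using exhaust_2[of q1] exhaust_2[of q2] exhaust_2[of q3] exhaust_2[of q4]
    by (elim disjE) (simp_all add: sum_2 initial_ket_def tensor_vec_def axis_def)
  thus ?thesis by (simp only: vec_eq_iff split_paired_All) blast
qed

lemma matrix_vector_mult_sum: "A *v (\<Sum>i\<in>I. x i) = (\<Sum>i\<in>I. A *v x i)"
  for A :: "complex^'n::finite^'m::finite"
  by (induction I rule: infinite_finite_induct) (simp_all add: matrix_vector_right_distrib)

lemma local_operation_initial_ket: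
  "((A \<otimes> S \<otimes> B) *v initial_ket \<psi> \<phi> a s b) $ (r, x, t)
   = (\<Sum>p1\<in>UNIV. \<Sum>p2\<in>UNIV. \<Sum>p3\<in>UNIV. \<Sum>p4\<in>UNIV. (\<psi> $ (p1, p2) * \<phi> $ (p3, p4)) *
       (amplitude A a r p1 * (amplitude S s x (p2, p3) * amplitude B b t p4)))"
  unfolding initial_ket_expand matrix_vector_mult_sum vector_scalar_commute tensor_mult_vec
  by (simp add: amplitude_def) (simp add: tensor_vec_def)

text \<open>Indexed by the traced-out systems, grouped as in \<open>reduce14\<close>; the slices
  form an unnormalized ensemble for the reduced state.\<close>

definition slice14 ::
  "complex^('a::finite alice \<times> 's::finite sapna \<times> 'b::finite bob) \<Rightarrow>
    (2 \<times> 2) \<times> 'a \<times> 's \<times> 'b \<Rightarrow> complex^(2 \<times> 2)" where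
  "slice14 V = (\<lambda>(q23, a, s, b). (\<chi> i. V $ ((fst i, a), (q23, s), (snd i, b))))"

lemma reduce14_ketbra: "reduce14 (ketbra V) = (\<Sum>z\<in>UNIV. ketbra (slice14 V z))"
  unfolding reduce14_def reindex_ketbra ptrace_snd_ketbra
  by (intro sum.cong refl) (auto simp: slice14_def ketbra_def vec_eq_iff)

lemma reduce14_sum: "reduce14 (\<Sum>i\<in>I. A i) = (\<Sum>i\<in>I. reduce14 (A i))"
  by (simp add: reduce14_def reindex_sum ptrace_snd_sum)

lemma reduce14_scaleR: "reduce14 (c *\<^sub>R A) = c *\<^sub>R reduce14 A"
  by (simp add: reduce14_def reindex_def ptrace_snd_def vec_eq_iff scaleR_sum_right case_prod_beta)

lemma trace_reduce14: "trace (reduce14 A) = trace A"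
  unfolding reduce14_def trace_ptrace_snd
  by (rule trace_reindex) (auto simp: bij_def inj_def surj_def)

lemma vdet_slice14_le:
  fixes A :: "'a::finite alice cmat" and S :: "'s::finite sapna cmat" and B :: "'b::finite bob cmat"
  shows "2 * cmod (vdet (slice14 ((A \<otimes> S \<otimes> B) *v initial_ket \<psi> \<phi> a s b) (q23, x, y, z)))
    \<le> 1 / 16 * (2 * cmod (vdet \<psi>)) * (2 * cmod (vdet \<phi>)) *
      ((\<Sum>p\<in>UNIV. \<Sum>q\<in>UNIV. (cmod (amplitude A a (q, x) p))\<^sup>2) *
       (\<Sum>p\<in>UNIV. (cmod (amplitude S s (q23, y) p))\<^sup>2) *
       (\<Sum>p\<in>UNIV. \<Sum>q\<in>UNIV. (cmod (amplitude B b (q, z) p))\<^sup>2))"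
proof -
  define F G H where "F = (\<lambda>q. amplitude A a (q, x))"
    and "G = (\<lambda>p2 p3. amplitude S s (q23, y) (p2, p3))" and "H = (\<lambda>q. amplitude B b (q, z))"
  have "slice14 ((A \<otimes> S \<otimes> B) *v initial_ket \<psi> \<phi> a s b) (q23, x, y, z)
      = (\<chi> i. \<Sum>p1\<in>UNIV. \<Sum>p2\<in>UNIV. \<Sum>p3\<in>UNIV. \<Sum>p4\<in>UNIV.
      (\<psi> $ (p1, p2) * \<phi> $ (p3, p4)) * (F (fst i) p1 * (G p2 p3 * H (snd i) p4)))"
    by (simp add: slice14_def local_operation_initial_ket F_def G_def H_def)
  \<comment> \<open>Five determinants each receive a factor 2 against one on the left, whence
    \<open>1 / 16\<close>.\<close>
  hence "2 * cmod (vdet (slice14 ((A \<otimes> S \<otimes> B) *v initial_ket \<psi> \<phi> a s b) (q23, x, y, z)))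
      = 1 / 16 * (2 * cmod (vdet \<psi>)) * (2 * cmod (vdet \<phi>)) *
        ((2 * cmod (det2 F)) * (2 * cmod (det2 G)) * (2 * cmod (det2 H)))"
    by (simp add: vdet_product norm_mult)
  also have "\<dots> \<le> 1 / 16 * (2 * cmod (vdet \<psi>)) * (2 * cmod (vdet \<phi>)) *
        ((\<Sum>p\<in>UNIV. \<Sum>q\<in>UNIV. (cmod (F q p))\<^sup>2) * (\<Sum>p\<in>UNIV. \<Sum>q\<in>UNIV. (cmod (G q p))\<^sup>2) *
         (\<Sum>p\<in>UNIV. \<Sum>q\<in>UNIV. (cmod (H q p))\<^sup>2))"
    by (intro mult_left_mono mult_mono det2_le_norm mult_nonneg_nonneg sum_nonneg) auto
  also have "(\<Sum>p\<in>UNIV. \<Sum>q\<in>UNIV. (cmod (G q p))\<^sup>2) = (\<Sum>p\<in>UNIV. (cmod (amplitude S s (q23, y) p))\<^sup>2)"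
    by (simp add: G_def sum_UNIV_prod sum_2)
  finally show ?thesis by (simp add: F_def H_def)
qed

text \<open>The index order is that of \<open>slice14\<close>; \<open>q\<close> and \<open>y\<close>
  both belong to Sapna's factor.\<close>

lemma sum_UNIV_prod_product:
  fixes f :: "'x::finite \<Rightarrow> real" and g :: "'q::finite \<Rightarrow> 'y::finite \<Rightarrow> real"
    and h :: "'z::finite \<Rightarrow> real"
  shows "(\<Sum>(q, x, y, z)\<in>UNIV. c * (f x * g q y * h z))
    = c * ((\<Sum>x\<in>UNIV. f x) * (\<Sum>q\<in>UNIV. \<Sum>y\<in>UNIV. g q y) * (\<Sum>z\<in>UNIV. h z))"
proof -
  have "(\<Sum>(q, x, y, z)\<in>UNIV. c * (f x * g q y * h z))
      = (\<Sum>q\<in>UNIV. \<Sum>x\<in>UNIV. \<Sum>y\<in>UNIV. \<Sum>z\<in>UNIV. c * f x * (g q y * h z))"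
    by (simp add: sum_UNIV_prod mult.assoc)
  also have "\<dots> = (\<Sum>q\<in>UNIV. \<Sum>x\<in>UNIV. c * f x * ((\<Sum>y\<in>UNIV. g q y) * (\<Sum>z\<in>UNIV. h z)))"
    by (simp only: sum_product) (simp only: sum_distrib_left)
  also have "\<dots> = c * ((\<Sum>x\<in>UNIV. f x) * (\<Sum>q\<in>UNIV. \<Sum>y\<in>UNIV. g q y) * (\<Sum>z\<in>UNIV. h z))"
    by (simp add: sum_distrib_left[symmetric] sum_distrib_right[symmetric] mult.assoc)
  finally show ?thesis .
qed

text \<open>In the bound for one slice, each laboratory's factor depends only on its own ancilla ket
  and fixed output indices, so the sum factorizes into weights.\<close>

lemma sum_vdet_slice14_le:
  fixes A :: "'a::finite alice cmat" and S :: "'s::finite sapna cmat" and B :: "'b::finite bob cmat"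
  assumes \<alpha>: "\<alpha> = (\<Sum>l\<in>L. ketbra (a l))" and \<gamma>: "\<gamma> = (\<Sum>m\<in>M. ketbra (s m))"
    and \<beta>: "\<beta> = (\<Sum>n\<in>N. ketbra (b n))"
  shows "(\<Sum>((i, k), (l, m, n))\<in>(I \<times> K) \<times> (L \<times> M \<times> N). \<Sum>z\<in>UNIV.
      2 * cmod (vdet (slice14 ((A \<otimes> S \<otimes> B) *v initial_ket (\<psi> i) (\<phi> k) (a l) (s m) (b n)) z)))
    \<le> 1 / 16 * (weight A \<alpha> * weight S \<gamma> * weight B \<beta>) *
      (\<Sum>i\<in>I. 2 * cmod (vdet (\<psi> i))) * (\<Sum>k\<in>K. 2 * cmod (vdet (\<phi> k)))"
proof -
  define c d where "c i = 2 * cmod (vdet (\<psi> i))" and "d k = 2 * cmod (vdet (\<phi> k))" for i k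
  define f g h where
    "f l x = (\<Sum>p\<in>UNIV. \<Sum>q\<in>UNIV. (cmod (amplitude A (a l) (q, x) p))\<^sup>2)" and
    "g m q y = (\<Sum>p\<in>UNIV. (cmod (amplitude S (s m) (q, y) p))\<^sup>2)" and
    "h n z = (\<Sum>p\<in>UNIV. \<Sum>q\<in>UNIV. (cmod (amplitude B (b n) (q, z) p))\<^sup>2)"
    for l x m q y n z
  have wA: "weight A \<alpha> = (\<Sum>l\<in>L. \<Sum>x\<in>UNIV. f l x)"
    unfolding weight_eq_sum_amplitude[OF \<alpha>] f_def sum_2
    by (simp add: sum_UNIV_prod sum_2 sum.distrib)
  have wB: "weight B \<beta> = (\<Sum>n\<in>N. \<Sum>z\<in>UNIV. h n z)"
    unfolding weight_eq_sum_amplitude[OF \<beta>] h_def sum_2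
    by (simp add: sum_UNIV_prod sum_2 sum.distrib)
  have "weight S \<gamma> = (\<Sum>m\<in>M. \<Sum>r\<in>UNIV. \<Sum>p\<in>UNIV. (cmod (amplitude S (s m) r p))\<^sup>2)"
    unfolding weight_eq_sum_amplitude[OF \<gamma>] by (intro sum.cong refl sum.swap)
  hence wS: "weight S \<gamma> = (\<Sum>m\<in>M. \<Sum>q\<in>UNIV. \<Sum>y\<in>UNIV. g m q y)"
    unfolding g_def by (subst (asm) sum_UNIV_prod)
  have "(\<Sum>((i, k), (l, m, n))\<in>(I \<times> K) \<times> (L \<times> M \<times> N). \<Sum>z\<in>UNIV.
      2 * cmod (vdet (slice14 ((A \<otimes> S \<otimes> B) *v initial_ket (\<psi> i) (\<phi> k) (a l) (s m) (b n)) z)))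
    \<le> (\<Sum>((i, k), (l, m, n))\<in>(I \<times> K) \<times> (L \<times> M \<times> N). \<Sum>(q, x, y, z)\<in>UNIV.
      1 / 16 * c i * d k * (f l x * g m q y * h n z))"
    unfolding c_def d_def f_def g_def h_def case_prod_beta
    by (intro sum_mono order.trans[OF _ vdet_slice14_le]) simp
  also have "\<dots> = (\<Sum>i\<in>I. \<Sum>k\<in>K. \<Sum>l\<in>L. \<Sum>m\<in>M. \<Sum>n\<in>N. 1 / 16 * c i * d k *
      ((\<Sum>x\<in>UNIV. f l x) * (\<Sum>q\<in>UNIV. \<Sum>y\<in>UNIV. g m q y) * (\<Sum>z\<in>UNIV. h n z)))"
    by (simp only: sum_UNIV_prod_product sum.cartesian_product' prod.case)
  also have "\<dots> = 1 / 16 * (weight A \<alpha> * weight S \<gamma> * weight B \<beta>) * (\<Sum>i\<in>I. c i) * (\<Sum>k\<in>K. d k)"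
    unfolding wA wS wB mult.assoc sum_distrib_left[symmetric] sum_distrib_right[symmetric]
    by (simp only: mult_ac)
  finally show ?thesis by (simp add: c_def d_def)
qed

section \<open>Protocols\<close>

text \<open>The contribution of one record, taken from the unnormalized state so that no round needs
  normalization.\<close>

definition average14 :: "('a::finite, 's::finite, 'b::finite) total cmat \<Rightarrow> real" where
  "average14 \<sigma> = Re (trace \<sigma>) * concurrence (reduce14 ((1 / Re (trace \<sigma>)) *\<^sub>R \<sigma>))"

lemma weight_nonneg: "density_operator \<alpha> \<Longrightarrow> 0 \<le> weight A \<alpha>"
  using psd_sum_ketbra[of \<alpha>]
  by (auto simp: density_operator_def weight_eq_sum_amplitude intro!: sum_nonneg)

lemma concurrence_nonneg:
  fixes \<rho> :: "(2 \<times> 2) cmat"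
  shows "density_operator \<rho> \<Longrightarrow> 0 \<le> concurrence \<rho>"
  using le_concurrence[of \<rho> 1 0] by (simp add: sum_nonneg)

text \<open>Ensembles for the inputs yield an ensemble of slices for the output. Those of
  \<open>\<rho>12\<close> and \<open>\<rho>34\<close> stay arbitrary for the infima; for the
  ancillas one choice suffices, since \<open>weight\<close> does not depend on it.\<close>

lemma average14_branch_le:
  fixes A :: "'a::finite alice cmat" and S :: "'s::finite sapna cmat" and B :: "'b::finite bob cmat"
  assumes "density_operator \<rho>12" "density_operator \<rho>34"
    and "density_operator \<alpha>" "density_operator \<gamma>" "density_operator \<beta>"
  shows "average14 (sandwich (A \<otimes> S \<otimes> B) (initial_state \<rho>12 \<rho>34 \<alpha> \<gamma> \<beta>))
    \<le> 1 / 16 * (weight A \<alpha> * weight S \<gamma> * weight B \<beta>) * concurrence \<rho>12 * concurrence \<rho>34"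
    (is "average14 ?\<sigma> \<le> ?w * _ * _")
proof -
  obtain nl nm nn a s b where \<alpha>: "\<alpha> = (\<Sum>l<(nl::nat). ketbra (a l))"
    and \<gamma>: "\<gamma> = (\<Sum>m<(nm::nat). ketbra (s m))" and \<beta>: "\<beta> = (\<Sum>n<(nn::nat). ketbra (b n))"
    using assms psd_sum_ketbra[of \<alpha>] psd_sum_ketbra[of \<beta>] psd_sum_ketbra[of \<gamma>]
    by (auto simp: density_operator_def)
  have w: "0 \<le> ?w" using assms by (simp add: weight_nonneg)
  have *: "average14 ?\<sigma> \<le> ?w * (\<Sum>i<ni. 2 * cmod (vdet (\<psi> i))) * (\<Sum>k<nk. 2 * cmod (vdet (\<phi> k)))"
    if \<psi>: "\<rho>12 = (\<Sum>i<(ni::nat). ketbra (\<psi> i))" and \<phi>: "\<rho>34 = (\<Sum>k<(nk::nat). ketbra (\<phi> k))"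
    for ni nk \<psi> \<phi>
  proof -
    define J where "J = ({..<ni} \<times> {..<nk}) \<times> ({..<nl} \<times> {..<nm} \<times> {..<nn})"
    define V where "V = (\<lambda>((i, k), (l, m, n)).
      (A \<otimes> S \<otimes> B) *v initial_ket (\<psi> i) (\<phi> k) (a l) (s m) (b n))"
    have "?\<sigma> = (\<Sum>j\<in>J. ketbra (V j))"
      unfolding \<psi> \<phi> \<alpha> \<beta> \<gamma> initial_state_eq_sum_ketbra sandwich_sum J_def V_def
      by (intro sum.cong refl) (auto simp: sandwich_ketbra)
    hence red: "reduce14 ?\<sigma> = (\<Sum>jz\<in>J \<times> UNIV. ketbra (case_prod (\<lambda>j. slice14 (V j)) jz))"
      by (simp add: reduce14_sum reduce14_ketbra sum.cartesian_product')
    have "Re (trace ?\<sigma>) * concurrence ((1 / Re (trace ?\<sigma>)) *\<^sub>R reduce14 ?\<sigma>)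
        \<le> (\<Sum>jz\<in>J \<times> UNIV. 2 * cmod (vdet (case_prod (\<lambda>j. slice14 (V j)) jz)))"
      by (rule concurrence_le_sum_vdet[OF _ red]) (simp_all add: J_def trace_reduce14)
    also have "\<dots> = (\<Sum>j\<in>J. \<Sum>z\<in>UNIV. 2 * cmod (vdet (slice14 (V j) z)))"
      by (simp add: sum.cartesian_product')
    also have "\<dots> \<le> ?w * (\<Sum>i<ni. 2 * cmod (vdet (\<psi> i))) * (\<Sum>k<nk. 2 * cmod (vdet (\<phi> k)))"
      using sum_vdet_slice14_le[OF \<alpha> \<gamma> \<beta>] by (simp add: J_def V_def case_prod_beta)
    finally show ?thesis by (simp add: average14_def reduce14_scaleR)
  qed
  show ?thesis
  \<comment> \<open>The infima are taken in turn: with an ensemble of \<open>\<rho>34\<close> fixed,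
    first the one over ensembles of \<open>\<rho>12\<close>.\<close>
  proof (rule le_concurrence[OF assms(2)])
    show "0 \<le> ?w * concurrence \<rho>12" using w concurrence_nonneg[OF assms(1)] by simp
  next
    fix nk \<phi> assume \<phi>: "\<rho>34 = (\<Sum>k<(nk::nat). ketbra (\<phi> k))"
    let ?d = "\<Sum>k<nk. 2 * cmod (vdet (\<phi> k))"
    have "average14 ?\<sigma> \<le> (?w * ?d) * concurrence \<rho>12"
    proof (rule le_concurrence[OF assms(1)])
      show "0 \<le> ?w * ?d" by (intro mult_nonneg_nonneg[OF w] sum_nonneg) auto
    next
      fix ni \<psi> assume "\<rho>12 = (\<Sum>i<(ni::nat). ketbra (\<psi> i))"
      from *[OF this \<phi>] show "average14 ?\<sigma> \<le> ?w * ?d * (\<Sum>i<ni. 2 * cmod (vdet (\<psi> i)))"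
        by (simp add: mult_ac)
    qed
    thus "average14 ?\<sigma> \<le> ?w * concurrence \<rho>12 * ?d" by (simp add: mult_ac)
  qed
qed

lemma sum_list_concat_map:
  "sum_list (map f (concat (map g [0..<n]))) = (\<Sum>i<n. sum_list (map f (g i)))"
  by (induction n) simp_all

text \<open>Generalizing over the accumulated product operator makes the induction work: the branch
  bound serves at the leaves, and conservation of weight at each round, whatever continuation each
  result selects.\<close>

lemma average14_protocol_le:
  fixes P :: "('a::finite, 's::finite, 'b::finite) protocol"
  assumes "locc P" "0 \<le> c"
    and branch: "\<And>A S B. average14 (sandwich (A \<otimes> S \<otimes> B) \<tau>)
      \<le> c * (weight A \<alpha> * weight S \<gamma> * weight B \<beta>)"
  shows "sum_list (map average14 (branches P (sandwich (A \<otimes> S \<otimes> B) \<tau>)))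
    \<le> c * (weight A \<alpha> * weight S \<gamma> * weight B \<beta>)"
  using assms(1)
proof (induction P arbitrary: A S B)
  case Stop
  thus ?case using branch by simp
next
  case (Alice n M P)
  \<comment> \<open>The new Kraus operator is absorbed into Alice's factor, preserving the product
    form; the other parties are treated alike.\<close>
  have "sum_list (map average14 (branches (Alice n M P) (sandwich (A \<otimes> S \<otimes> B) \<tau>)))
      = (\<Sum>i<n. sum_list (map average14 (branches (P i) (sandwich ((M i ** A) \<otimes> S \<otimes> B) \<tau>))))"
    by (simp add: sum_list_concat_map tensor_mult flip: sandwich_mult)
  also have "\<dots> \<le> (\<Sum>i<n. c * (weight (M i ** A) \<alpha> * weight S \<gamma> * weight B \<beta>))"
    using Alice by (intro sum_mono) auto
  also have "\<dots> = c * (weight A \<alpha> * weight S \<gamma> * weight B \<beta>)"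
    using Alice.prems by (simp add: weight_measurement flip: sum_distrib_left sum_distrib_right)
  finally show ?case .
next
  case (Sapna n M P)
  have "sum_list (map average14 (branches (Sapna n M P) (sandwich (A \<otimes> S \<otimes> B) \<tau>)))
      = (\<Sum>i<n. sum_list (map average14 (branches (P i) (sandwich (A \<otimes> (M i ** S) \<otimes> B) \<tau>))))"
    by (simp add: sum_list_concat_map tensor_mult flip: sandwich_mult)
  also have "\<dots> \<le> (\<Sum>i<n. c * (weight A \<alpha> * weight (M i ** S) \<gamma> * weight B \<beta>))"
    using Sapna by (intro sum_mono) auto
  also have "\<dots> = c * (weight A \<alpha> * weight S \<gamma> * weight B \<beta>)"
    using Sapna.prems by (simp add: weight_measurement flip: sum_distrib_left sum_distrib_right)
  finally show ?case .
next
  case (Bob n M P)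
  have "sum_list (map average14 (branches (Bob n M P) (sandwich (A \<otimes> S \<otimes> B) \<tau>)))
      = (\<Sum>i<n. sum_list (map average14 (branches (P i) (sandwich (A \<otimes> S \<otimes> (M i ** B)) \<tau>))))"
    by (simp add: sum_list_concat_map tensor_mult flip: sandwich_mult)
  also have "\<dots> \<le> (\<Sum>i<n. c * (weight A \<alpha> * weight S \<gamma> * weight (M i ** B) \<beta>))"
    using Bob by (intro sum_mono) auto
  also have "\<dots> = c * (weight A \<alpha> * weight S \<gamma> * weight B \<beta>)"
    using Bob.prems by (simp add: weight_measurement flip: sum_distrib_left sum_distrib_right)
  finally show ?case .
qed

theorem theorem1:
  fixes \<rho>12 \<rho>34 :: "(2 \<times> 2) cmat"
    and \<alpha> :: "'a::finite cmat" and \<gamma> :: "'s::finite cmat" and \<beta> :: "'b::finite cmat"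
    and P :: "('a, 's, 'b) protocol"
  assumes "density_operator \<rho>12" and "density_operator \<rho>34"
    and "density_operator \<alpha>" and "density_operator \<gamma>" and "density_operator \<beta>"
    and "locc P"
  shows "(\<Sum>(Q, \<sigma>)\<leftarrow>outcomes P (initial_state \<rho>12 \<rho>34 \<alpha> \<gamma> \<beta>). Q * concurrence \<sigma>)
           \<le> concurrence \<rho>12 * concurrence \<rho>34"
proof -
  let ?\<tau> = "initial_state \<rho>12 \<rho>34 \<alpha> \<gamma> \<beta>"
  let ?c = "1 / 16 * (concurrence \<rho>12 * concurrence \<rho>34)"
  have c: "0 \<le> ?c" using assms(1,2) by (simp add: concurrence_nonneg)
  have branch: "average14 (sandwich (A \<otimes> S \<otimes> B) ?\<tau>)
      \<le> ?c * (weight A \<alpha> * weight S \<gamma> * weight B \<beta>)" for A S B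
    using average14_branch_le[OF assms(1-5), of A S B] by (simp add: mult_ac)
  \<comment> \<open>The identity serves as the initial accumulated operator.\<close>
  have "(\<Sum>(Q, \<sigma>)\<leftarrow>outcomes P ?\<tau>. Q * concurrence \<sigma>)
      = sum_list (map average14 (branches P (sandwich (mat 1 \<otimes> mat 1 \<otimes> mat 1) ?\<tau>)))"
    by (simp add: outcomes_def average14_def[abs_def] Let_def comp_def)
  also have "\<dots> \<le> ?c * (weight (mat 1 :: 'a alice cmat) \<alpha> * weight (mat 1 :: 's sapna cmat) \<gamma>
      * weight (mat 1 :: 'b bob cmat) \<beta>)"
    by (rule average14_protocol_le[OF assms(6) c branch])
  \<comment> \<open>The weights are 2, 4 and 2, which cancel \<open>1 / 16\<close>.\<close>
  also have "\<dots> = concurrence \<rho>12 * concurrence \<rho>34"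
    using assms(3-5) by (simp add: weight_mat_1)
  finally show ?thesis .
qed

end
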